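(* Let $n\ge1$. 1. For every fixed point $\zeta\in\partial D^n$, the set of functions in $C(\partial D^n)$ that are not holomorphically extendable at $\zeta$ is a dense $G_\delta$ subset of $C(\partial D^n)$; likewise, the set of functions in $C(\partial D^n)$ that are holomorphically extendable at no point of $\partial D^n$ is a dense $G_\delta$ subset of $C(\partial D^n)$. 2. For every fixed point $\zeta\in\partial B^n$, the set of functions in $C(\partial B^n)$ that are not holomorphically extendable at $\zeta$ is a dense $G_\delta$ subset of $C(\partial B^n)$; likewise, the set of functions in $C(\partial B^n)$ that are holomorphically extendable at no point of $\partial B^n$ is a dense $G_\delta$ subset of $C(\partial B^n)$.
   Context: $D$ is the open unit disc in $\mathbb{C}$, $D^n\subseteq\mathbb{C}^n$ the open unit polydisc (with full topological boundary $\partial D^n$), and $B^n$ the open Euclidean unit ball of $\mathbb{C}^n$. For a compact set $L\subseteq\mathbb{C}^n$, $C(L)$ is the Banach space of continuous functions $L\to\mathbb{C}$ with the supremum norm. A function $f\in C(L)$ is holomorphically extendable at $\zeta\in L$ if there are an open neighborhood $U\subseteq\mathbb{C}^n$ of $\zeta$ and a holomorphic function $F:U\to\mathbb{C}$ such that $F=f$ on $U\cap L$. *)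

theory Defs
  imports "HOL-Analysis.Analysis"
begin

text \<open>
  A function of several complex variables is holomorphic on an open set if at each point it has
  a Frechet derivative that is complex linear. Additivity of \<open>F'\<close> is part of
  \<^const>\<open>has_derivative\<close>, so only complex homogeneity has to be added.
\<close>

definition holomorphic_vec_on :: "(complex ^ 'n \<Rightarrow> complex) \<Rightarrow> (complex ^ 'n) set \<Rightarrow> bool"
  where "holomorphic_vec_on F U \<longleftrightarrow>
    (\<forall>z\<in>U. \<exists>F'. (F has_derivative F') (at z) \<and> (\<forall>c v. F' (c *s v) = c * F' v))"

definition holomorphically_extendable_at ::
    "(complex ^ 'n) set \<Rightarrow> (complex ^ 'n \<Rightarrow> complex) \<Rightarrow> complex ^ 'n \<Rightarrow> bool"
  where "holomorphically_extendable_at L f \<zeta> \<longleftrightarrow>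
    (\<exists>U F. open U \<and> \<zeta> \<in> U \<and> holomorphic_vec_on F U \<and> (\<forall>z\<in>U \<inter> L. F z = f z))"

definition unit_polydisc :: "(complex ^ 'n) set"
  where "unit_polydisc = {z. \<forall>i. norm (z $ i) < 1}"

text \<open>
  \<open>C(L)\<close> for compact \<open>L\<close>, as a metric space. Elements are total HOL functions, made unique
  representatives of functions on \<open>L\<close> by being \<^const>\<open>extensional\<close>; the distance is the supremum
  distance over \<open>L\<close>. The two lemmas below confirm this reading.
\<close>

definition C_space :: "(complex ^ 'n) set \<Rightarrow> (complex ^ 'n \<Rightarrow> complex) metric"
  where "C_space L = cfunspace (top_of_set L) euclidean_metric"

lemma mspace_C_space:
  assumes "compact L"
  shows "mspace (C_space L) = {f \<in> extensional L. continuous_on L f}"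
  using compact_continuous_image[OF _ assms]
  by (auto simp: C_space_def intro: compact_imp_bounded)

lemma mdist_C_space:
  assumes "compact L" "L \<noteq> {}" "f \<in> mspace (C_space L)" "g \<in> mspace (C_space L)"
  shows "mdist (C_space L) f g = (SUP z\<in>L. norm (f z - g z))"
  using assms
  by (auto simp: C_space_def mdist_cfunspace_eq_mdist_funspace Met_TC.fdist_def Met_TC.fspace_def
      dist_norm)

definition dense_gdelta_in :: "'a topology \<Rightarrow> 'a set \<Rightarrow> bool"
  where "dense_gdelta_in X S \<longleftrightarrow> gdelta_in X S \<and> X closure_of S = topspace X"

definition non_extendable_at :: "(complex ^ 'n) set \<Rightarrow> complex ^ 'n \<Rightarrow> (complex ^ 'n \<Rightarrow> complex) set"
  where "non_extendable_at L \<zeta> =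
    {f \<in> mspace (C_space L). \<not> holomorphically_extendable_at L f \<zeta>}"

definition nowhere_extendable :: "(complex ^ 'n) set \<Rightarrow> (complex ^ 'n \<Rightarrow> complex) set"
  where "nowhere_extendable L =
    {f \<in> mspace (C_space L). \<forall>\<zeta>\<in>L. \<not> holomorphically_extendable_at L f \<zeta>}"

end

theory Submission
  imports Defs "HOL-Complex_Analysis.Cauchy_Integral_Formula"
begin

text \<open>
  Both boundaries are nonempty compact sets without isolated points, and the theorem is proved
  for every set \<open>L\<close> of this kind.

  The functions that extend at \<open>\<zeta>\<close> form an \<open>F\<^sub>\<sigma>\<close>. A holomorphic function near \<open>\<zeta>\<close> has, on
  some small ball, a bound on its values and gradients and a quadratic bound on its first order
  Taylor remainder (\<open>holomorphic_vec_has_jet\<close>, by the Cauchy inequalities on complex lines).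
  Conversely, any function that admits a candidate gradient with such a remainder bound is
  holomorphic (\<open>holomorphic_jet\<close>). Every one of these conditions is an inequality between finitely
  many values of the function and its gradient, so it survives pointwise limits, and by Tychonoff's
  theorem the admissible pairs of function and gradient on a fixed ball with a fixed bound form a
  compact set (\<open>compact_jets\<close>). This replaces Montel's theorem: the functions in \<open>C(L)\<close> that agree
  near \<open>\<zeta>\<close> with an admissible function are closed (\<open>closedin_jet_extendable\<close>), and there
  are countably many such sets, one for each radius \<open>1 / (m + 1)\<close> with bound \<open>m\<close>.

  The functions that do not extend at \<open>\<zeta>\<close> are dense because one of them exists: adding a small
  multiple of it to an extendable function destroys extendability. The square root of the distance
  to \<open>\<zeta>\<close> does not extend, since \<open>\<zeta>\<close> is a limit point of \<open>L\<close> and a differentiable function grows at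
  most linearly away from a zero (\<open>sqrt_dist_not_extendable\<close>).

  Extendability at a point passes to all nearby points of \<open>L\<close>, so being extendable nowhere can be
  tested on a countable dense subset of \<open>L\<close>, and the Baire category theorem in the complete space
  \<open>C(L)\<close> gives the second kind of statement. Finally, the boundary of a bounded open circled set
  that contains 0 has no isolated points, because each boundary point moves along a circle in the
  boundary (\<open>frontier_circled_islimpt\<close>); polydisc and ball are of this kind.
\<close>

section \<open>Scalar multiplication by complex numbers\<close>

lemma norm_smult_vec: "norm (c *s v) = norm c * norm (v :: complex ^ 'n)"
  by (simp add: norm_vec_def norm_mult L2_set_right_distrib)

lemma bounded_linear_smult_right: "bounded_linear (\<lambda>t. t *s (v :: complex ^ 'n))"
  by (rule bounded_linear_intro[where K = "norm v"])
     (auto simp: norm_smult_vec vec_eq_iff algebra_simps)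

lemma bounded_linear_smult_left: "bounded_linear (\<lambda>v. c *s (v :: complex ^ 'n))"
  by (rule bounded_linear_intro[where K = "norm c"])
     (auto simp: norm_smult_vec vec_eq_iff algebra_simps)

section \<open>Cauchy estimates along complex lines\<close>

text \<open>
  Cauchy's inequality on circles of radius \<open>R / 2\<close> bounds the first derivative at 0 and, once
  \<open>R > 2\<close> makes these circles fit around every point of the closed unit disc, the second derivative
  on that disc, which controls the Taylor remainder at 1.
\<close>

lemma Cauchy_Taylor_estimates:
  assumes hol: "g holomorphic_on ball 0 R" and R: "R > 0"
    and M: "\<And>t. t \<in> ball 0 R \<Longrightarrow> norm (g t) \<le> M"
  shows "norm (deriv g 0) \<le> 2 * M / R"
    and "R > 2 \<Longrightarrow> norm (g 1 - g 0 - deriv g 0) \<le> 8 * M / R ^ 2"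
proof -
  have C: "norm ((deriv ^^ k) g t) \<le> fact k * M / (R / 2) ^ k" if t: "norm t < R / 2" for k t
  proof (rule Cauchy_inequality)
    have sub: "cball t (R / 2) \<subseteq> ball 0 R"
      using t by (simp add: cball_subset_ball_iff dist_norm)
    show "g holomorphic_on ball t (R / 2)"
      using hol ball_subset_cball sub by (meson holomorphic_on_subset subset_trans)
    show "continuous_on (cball t (R / 2)) g"
      using hol sub continuous_on_subset holomorphic_on_imp_continuous_on by blast
    show "norm (g x) \<le> M" if "norm (t - x) = R / 2" for x
      using that sub by (intro M) (auto simp: dist_norm subset_iff)
  qed (use R in auto)
  show "norm (deriv g 0) \<le> 2 * M / R"
    using C[of 0 1] R by (simp add: mult.commute)
  assume R2: "R > 2"
  have der: "((deriv ^^ i) g has_field_derivative (deriv ^^ Suc i) g x) (at x within cball 0 1)"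
    if "x \<in> cball 0 1" for i x
    using that R2
    by (intro has_field_derivative_at_within[OF has_field_derivative_higher_deriv[OF hol]]) auto
  have "norm ((deriv ^^ Suc 1) g x) \<le> 8 * M / R\<^sup>2" if "x \<in> cball 0 1" for x
  proof -
    have "norm ((deriv ^^ Suc 1) g x) \<le> fact 2 * M / (R / 2) ^ 2"
      using C[of x "Suc 1"] that R2 unfolding Suc_1 by simp
    then show ?thesis
      by (simp add: power_divide)
  qed
  \<comment> \<open>The second derivative bounds the remainder after the linear term.\<close>
  from complex_Taylor[where f = "\<lambda>i. (deriv ^^ i) g" and S = "cball 0 1" and n = 1 and w = 0 and z = 1,
      OF convex_cball der this]
  show "norm (g 1 - g 0 - deriv g 0) \<le> 8 * M / R ^ 2"
    by (simp add: diff_diff_eq)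
qed

text \<open>
  Restricting \<open>F\<close> to the complex line through \<open>z\<close> in direction \<open>v\<close> gives a function of one variable on
  a disc of radius \<open>r / norm v\<close>, which turns the previous estimates into linear and quadratic bounds
  in \<open>norm v\<close>.
\<close>

lemma holomorphic_vec_estimates:
  fixes F :: "complex ^ 'n \<Rightarrow> complex"
  assumes hol: "holomorphic_vec_on F (ball z r)" and r: "r > 0"
    and M: "\<And>w. w \<in> ball z r \<Longrightarrow> norm (F w) \<le> M"
    and F': "(F has_derivative F') (at z)" "\<And>c v. F' (c *s v) = c * F' v"
  shows "norm (F' v) \<le> 2 * M / r * norm v"
    and "norm v < r / 2 \<Longrightarrow> norm (F (z + v) - F z - F' v) \<le> 8 * M / r ^ 2 * norm v ^ 2"
proof -
  have "norm (F' v) \<le> 2 * M / r * norm v \<and>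
    (norm v < r / 2 \<longrightarrow> norm (F (z + v) - F z - F' v) \<le> 8 * M / r ^ 2 * norm v ^ 2)"
  proof (cases "v = 0")
    case True
    then show ?thesis
      using F'(2)[of 0 0] by simp
  next
    case False
    define R where "R = r / norm v"
    define g where "g t = F (z + t *s v)" for t
    have R: "R > 0"
      using False r by (simp add: R_def)
    have mem: "z + t *s v \<in> ball z r" if "t \<in> ball 0 R" for t
      using that False by (simp add: dist_norm norm_smult_vec R_def field_simps)
    have der: "(g has_field_derivative D v) (at t)"
      if D: "(F has_derivative D) (at (z + t *s v))" "\<And>c v. D (c *s v) = c * D v" for t D
    proof -
      have "((\<lambda>t. z + t *s v) has_derivative (\<lambda>t. t *s v)) (at t)"
        by (auto intro!: derivative_eq_intros bounded_linear.has_derivative[OF bounded_linear_smult_right])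
      from has_derivative_compose[OF this D(1)] have "(g has_derivative (\<lambda>t. t * D v)) (at t)"
        by (simp add: g_def[abs_def] D(2))
      moreover have "(\<lambda>t. t * D v) = (*) (D v)"
        by (rule ext) (rule mult.commute)
      ultimately show ?thesis
        by (simp add: has_field_derivative_def)
    qed
    have "g holomorphic_on ball 0 R"
      unfolding holomorphic_on_open[OF open_ball]
      using hol mem der unfolding holomorphic_vec_on_def by meson
    moreover have "norm (g t) \<le> M" if "t \<in> ball 0 R" for t
      unfolding g_def using M mem that by blast
    moreover have "deriv g 0 = F' v"
      using der[of F' 0] F' by (intro DERIV_imp_deriv) simp
    ultimately have "norm (F' v) \<le> 2 * M / R"
      and "R > 2 \<longrightarrow> norm (g 1 - g 0 - F' v) \<le> 8 * M / R ^ 2"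
      using Cauchy_Taylor_estimates[OF _ R, of g M] by auto
    moreover have "R > 2 \<longleftrightarrow> norm v < r / 2"
      using False by (simp add: R_def field_simps)
    ultimately show ?thesis
      by (simp add: R_def g_def power_divide)
  qed
  then show "norm (F' v) \<le> 2 * M / r * norm v"
    and "norm v < r / 2 \<Longrightarrow> norm (F (z + v) - F z - F' v) \<le> 8 * M / r ^ 2 * norm v ^ 2"
    by blast+
qed

section \<open>Holomorphic functions with uniformly bounded first order jets\<close>

text \<open>
  The pair \<open>G z\<close> is to be read as the value at \<open>z\<close> of a function together with its complex gradient.
  The norm bound is demanded at all points, not only in \<open>S\<close>, so that \<open>jets S K\<close> lies in a product of
  compact balls indexed by the whole space.
\<close>

definition jets ::
    "(complex ^ 'n) set \<Rightarrow> real \<Rightarrow> (complex ^ 'n \<Rightarrow> complex \<times> (complex ^ 'n)) set"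
  where "jets S K =
    {G. (\<forall>z. norm (G z) \<le> K) \<and>
        (\<forall>z\<in>S. \<forall>w\<in>S. norm (fst (G w) - fst (G z) - (\<Sum>i\<in>UNIV. snd (G z) $ i * (w - z) $ i))
          \<le> K * norm (w - z) ^ 2)}"

lemma jets_mono:
  assumes "S' \<subseteq> S" "K \<le> K'"
  shows "jets S K \<subseteq> jets S' K'"
proof -
  have "K * x ^ 2 \<le> K' * x ^ 2" for x :: real
    using assms(2) by (simp add: mult_right_mono)
  then show ?thesis
    unfolding jets_def using assms by (smt (verit) Collect_mono subsetD)
qed

lemma closed_Collect_ball:
  assumes "\<And>z. z \<in> S \<Longrightarrow> closed {x. P x z}"
  shows "closed {x. \<forall>z\<in>S. P x z}"
proof -
  have "{x. \<forall>z\<in>S. P x z} = (\<Inter>z\<in>S. {x. P x z})"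
    by auto
  then show ?thesis
    using assms by auto
qed

text \<open>
  Tychonoff's theorem for the topology of pointwise convergence; each defining inequality involves
  only finitely many coordinates of \<open>G\<close> and hence cuts out a closed set.
\<close>

lemma compact_jets: "compact (jets S K)"
proof -
  have "compactin (product_topology (\<lambda>_. euclidean) UNIV) 
      (Pi\<^sub>E UNIV (\<lambda>_ :: complex ^ 'n. cball (0 :: complex \<times> (complex ^ 'n)) K))"
    by (simp add: compactin_PiE)
  then have "compact (Pi\<^sub>E UNIV (\<lambda>_ :: complex ^ 'n. cball (0 :: complex \<times> (complex ^ 'n)) K))"
    by (simp add: euclidean_product_topology)
  moreover have "closed (jets S K)"
    unfolding jets_def
    by (intro closed_Collect_conj closed_Collect_all closed_Collect_ball closed_Collect_le
          continuous_intros continuous_on_product_coordinates)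
  moreover have "jets S K = Pi\<^sub>E UNIV (\<lambda>_. cball 0 K) \<inter> jets S K"
    by (auto simp: jets_def)
  ultimately show ?thesis
    by (metis compact_Int_closed)
qed

text \<open>
  The quadratic remainder bound says directly that the second component is the derivative of the
  first.
\<close>

lemma holomorphic_jet:
  assumes G: "G \<in> jets S K" and S: "open S"
  shows "holomorphic_vec_on (\<lambda>z. fst (G z)) S"
  unfolding holomorphic_vec_on_def
proof
  fix z assume z: "z \<in> S"
  define D where "D v = (\<Sum>i\<in>UNIV. snd (G z) $ i * v $ i)" for v
  have "norm (G z) \<le> K"
    using G by (simp add: jets_def)
  then have K: "K \<ge> 0"
    using norm_ge_zero order_trans by blast
  have "bounded_linear D"
    unfolding D_def
    by (intro bounded_linear_sum bounded_linear_const_mult bounded_linear_vec_nth)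
  moreover have "\<exists>d>0. \<forall>w. norm (w - z) < d \<longrightarrow>
      norm (fst (G w) - fst (G z) - D (w - z)) \<le> e * norm (w - z)" if e: "e > 0" for e
  proof -
    obtain d where d: "d > 0" "ball z d \<subseteq> S"
      using S z openE by blast
    \<comment> \<open>Within \<open>e / (K + 1)\<close> the quadratic bound is below \<open>e * norm (w - z)\<close>.\<close>
    define d' where "d' = min d (e / (K + 1))"
    have "norm (fst (G w) - fst (G z) - D (w - z)) \<le> e * norm (w - z)" if w: "norm (w - z) < d'" for w
    proof -
      have "w \<in> S"
        using w d by (auto simp: d'_def dist_norm norm_minus_commute subset_iff)
      then have "norm (fst (G w) - fst (G z) - D (w - z)) \<le> (K * norm (w - z)) * norm (w - z)"
        using G z by (simp add: jets_def D_def power2_eq_square mult.assoc)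
      also have "K * norm (w - z) \<le> (K + 1) * norm (w - z)"
        by (simp add: algebra_simps)
      also have "(K + 1) * norm (w - z) \<le> e"
        using w K by (simp add: d'_def field_simps)
      finally show ?thesis
        by (simp add: mult_right_mono)
    qed
    moreover have "d' > 0"
      using d e K by (simp add: d'_def)
    ultimately show ?thesis
      by blast
  qed
  ultimately have "((\<lambda>z. fst (G z)) has_derivative D) (at z)"
    by (simp add: has_derivative_at_alt)
  moreover have "D (c *s v) = c * D v" for c v
    by (simp add: D_def sum_distrib_left algebra_simps)
  ultimately show "\<exists>F'. ((\<lambda>z. fst (G z)) has_derivative F') (at z) \<and> (\<forall>c v. F' (c *s v) = c * F' v)"
    by blast
qed

text \<open>
  The quadratic estimate needs the increment \<open>w - z\<close> to be shorter than half the radius of a ball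
  around \<open>z\<close> on which \<open>F\<close> is bounded, which is why the ball is shrunk from \<open>2 * r\<close> to \<open>r / 4\<close>.
\<close>

lemma holomorphic_vec_has_jet:
  fixes F :: "complex ^ 'n \<Rightarrow> complex"
  assumes hol: "holomorphic_vec_on F U" and U: "open U" "\<zeta> \<in> U"
  obtains r K G where "r > 0" "G \<in> jets (ball \<zeta> r) K" "\<And>z. z \<in> ball \<zeta> r \<Longrightarrow> fst (G z) = F z"
proof -
  obtain r where r: "r > 0" "cball \<zeta> (2 * r) \<subseteq> U"
  proof -
    obtain e where "e > 0" "cball \<zeta> e \<subseteq> U"
      using U open_contains_cball by blast
    then show ?thesis
      using that[of "e / 2"] by simp
  qed
  have "continuous_on U F"
    using hol U unfolding holomorphic_vec_on_def
    by (meson continuous_at_imp_continuous_on has_derivative_continuous)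
  then have "compact (F ` cball \<zeta> (2 * r))"
    using r by (intro compact_continuous_image) (auto intro: continuous_on_subset)
  then obtain M where M: "\<And>w. w \<in> cball \<zeta> (2 * r) \<Longrightarrow> norm (F w) \<le> M"
    by (meson bounded_iff compact_imp_bounded imageI)
  have M0: "M \<ge> 0"
    using M[of \<zeta>] r norm_ge_zero[of "F \<zeta>"] by (auto simp del: norm_ge_zero)
  obtain F' where F': "\<And>z. z \<in> U \<Longrightarrow> (F has_derivative F' z) (at z)"
      "\<And>z c v. z \<in> U \<Longrightarrow> F' z (c *s v) = c * F' z v"
    using hol unfolding holomorphic_vec_on_def by metis
  \<comment> \<open>The complex gradient: by complex linearity, pairing with it is the derivative.\<close>
  define A where "A z = (\<chi> i. F' z (axis i 1))" for z
  have A: "(\<Sum>i\<in>UNIV. A z $ i * v $ i) = F' z v" if "z \<in> U" for z v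
  proof -
    have "F' z v = F' z (\<Sum>i\<in>UNIV. v $ i *s axis i 1)"
      by (simp add: basis_expansion)
    also have "\<dots> = (\<Sum>i\<in>UNIV. F' z (v $ i *s axis i 1))"
      using F'(1)[OF that] has_derivative_linear linear_sum by blast
    finally show ?thesis
      using F'(2)[OF that] by (simp add: A_def mult.commute)
  qed
  have sub: "ball z r \<subseteq> cball \<zeta> (2 * r)" "z \<in> U" if "z \<in> ball \<zeta> r" for z
  proof -
    show "ball z r \<subseteq> cball \<zeta> (2 * r)"
      using that r by (simp add: ball_subset_cball_iff dist_commute)
    then show "z \<in> U"
      using r by (auto simp: subset_iff)
  qed
  have est: "norm (F' z v) \<le> 2 * M / r * norm v"
      "norm v < r / 2 \<Longrightarrow> norm (F (z + v) - F z - F' z v) \<le> 8 * M / r ^ 2 * norm v ^ 2"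
    if "z \<in> ball \<zeta> r" for z v
    using holomorphic_vec_estimates[of F z r M "F' z" v] hol sub[OF that] r M F'(1)[of z] F'(2)[of z]
    unfolding holomorphic_vec_on_def by blast+
  define K where "K = max (M + real CARD('n) * (2 * M / r)) (8 * M / r ^ 2)"
  define G where "G z = (if z \<in> ball \<zeta> (r / 4) then (F z, A z) else 0)" for z
  have K0: "K \<ge> 0"
    using M0 r by (simp add: K_def le_max_iff_disj)
  have "norm (G z) \<le> K" for z
  proof (cases "z \<in> ball \<zeta> (r / 4)")
    case True
    then have z: "z \<in> ball \<zeta> r"
      using r by simp
    have "norm (A z) \<le> (\<Sum>i\<in>UNIV. norm (A z $ i))"
      unfolding norm_vec_def by (rule L2_set_le_sum) simp
    also have "\<dots> \<le> (\<Sum>i\<in>(UNIV :: 'n set). 2 * M / r)"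
    proof (rule sum_mono)
      fix i
      show "norm (A z $ i) \<le> 2 * M / r"
        using est(1)[OF z, of "axis i 1"] by (simp add: A_def)
    qed
    finally have "norm (A z) \<le> real CARD('n) * (2 * M / r)"
      by simp
    moreover have "norm (F z) \<le> M"
      using z r by (intro M) auto
    ultimately show ?thesis
      using True norm_Pair_le[of "F z" "A z"] by (simp add: G_def K_def)
  qed (simp add: G_def K0)
  moreover have "norm (fst (G w) - fst (G z) - (\<Sum>i\<in>UNIV. snd (G z) $ i * (w - z) $ i))
          \<le> K * norm (w - z) ^ 2" if zw: "z \<in> ball \<zeta> (r / 4)" "w \<in> ball \<zeta> (r / 4)" for z w
  proof -
    have z: "z \<in> ball \<zeta> r"
      using r zw by simp
    have "dist z w < r / 2"
      using zw dist_triangle[of z w \<zeta>] by (simp add: dist_commute)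
    then have "norm (F w - F z - F' z (w - z)) \<le> 8 * M / r ^ 2 * norm (w - z) ^ 2"
      using est(2)[OF z, of "w - z"] by (simp add: dist_norm norm_minus_commute)
    also have "\<dots> \<le> K * norm (w - z) ^ 2"
      by (intro mult_right_mono) (auto simp: K_def)
    finally show ?thesis
      using zw A[of z "w - z"] sub(2)[OF z] by (simp add: G_def)
  qed
  ultimately have "G \<in> jets (ball \<zeta> (r / 4)) K"
    by (simp add: jets_def)
  then show ?thesis
    using r by (intro that[of "r / 4" G K]) (auto simp: G_def)
qed


section \<open>Extendable functions form a countable union of closed sets\<close>

definition jet_extendable :: "(complex ^ 'n) set \<Rightarrow> complex ^ 'n \<Rightarrow> nat \<Rightarrow> (complex ^ 'n \<Rightarrow> complex) set"
  where "jet_extendable L \<zeta> m = {f \<in> mspace (C_space L).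
    \<exists>G \<in> jets (ball \<zeta> (1 / Suc m)) (real m). \<forall>z \<in> ball \<zeta> (1 / Suc m) \<inter> L. fst (G z) = f z}"

text \<open>
  Shrinking the ball and raising the bound enlarges the set of admissible jets, so that a single
  index \<open>m\<close> can control both.
\<close>

lemma extendable_iff_jet_extendable:
  assumes f: "f \<in> mspace (C_space L)"
  shows "holomorphically_extendable_at L f \<zeta> \<longleftrightarrow> (\<exists>m. f \<in> jet_extendable L \<zeta> m)"
proof
  assume "holomorphically_extendable_at L f \<zeta>"
  then obtain U F where F: "open U" "\<zeta> \<in> U" "holomorphic_vec_on F U" "\<forall>z\<in>U \<inter> L. F z = f z"
    unfolding holomorphically_extendable_at_def by blast
  obtain d where d: "d > 0" "ball \<zeta> d \<subseteq> U"
    using F openE by blast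
  obtain r K G where G: "r > 0" "G \<in> jets (ball \<zeta> r) K" "\<And>z. z \<in> ball \<zeta> r \<Longrightarrow> fst (G z) = F z"
    by (rule holomorphic_vec_has_jet[OF F(3,1,2)]) (rule that)
  obtain k where k: "1 / Suc k < min d r"
    using nat_approx_posE[of "min d r"] d G by auto
  define m where "m = max k (nat \<lceil>K\<rceil>)"
  have "1 / real (Suc m) \<le> 1 / real (Suc k)"
    by (intro divide_left_mono) (auto simp: m_def)
  moreover have "real (nat \<lceil>K\<rceil>) \<le> real m"
    by (simp add: m_def)
  ultimately have m: "1 / Suc m < min d r" "K \<le> real m"
    using k real_nat_ceiling_ge[of K] by linarith+
  then have "G \<in> jets (ball \<zeta> (1 / Suc m)) (real m)"
    using jets_mono[of "ball \<zeta> (1 / Suc m)" "ball \<zeta> r" K "real m"] G by (auto simp: subset_ball)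
  moreover have "fst (G z) = f z" if "z \<in> ball \<zeta> (1 / Suc m) \<inter> L" for z
  proof -
    have "z \<in> U" "z \<in> ball \<zeta> r"
      using that m(1) d(2) by (auto simp: subset_iff)
    then show ?thesis
      using that G(3) F(4) by auto
  qed
  ultimately have "f \<in> jet_extendable L \<zeta> m"
    using f unfolding jet_extendable_def by blast
  then show "\<exists>m. f \<in> jet_extendable L \<zeta> m" ..
next
  assume "\<exists>m. f \<in> jet_extendable L \<zeta> m"
  then obtain m G where G: "G \<in> jets (ball \<zeta> (1 / Suc m)) (real m)"
      "\<forall>z \<in> ball \<zeta> (1 / Suc m) \<inter> L. fst (G z) = f z"
    unfolding jet_extendable_def by blast
  show "holomorphically_extendable_at L f \<zeta>"
    unfolding holomorphically_extendable_at_def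
    using G holomorphic_jet[OF G(1)]
    by (intro exI[of _ "ball \<zeta> (1 / Suc m)"] exI[of _ "\<lambda>z. fst (G z)"]) auto
qed

lemma C_space_dist_le:
  assumes "compact L" "f \<in> mspace (C_space L)" "g \<in> mspace (C_space L)" "z \<in> L"
  shows "norm (f z - g z) \<le> mdist (C_space L) f g"
  using mdist_cfunspace_imp_mdist_le[of f "top_of_set L" euclidean_metric g _ z] assms
  by (simp add: C_space_def dist_norm)

text \<open>
  For \<open>f\<close> in the closure, the jets that reproduce \<open>f\<close> up to \<open>1 / (k + 1)\<close> form a decreasing sequence of
  nonempty closed subsets of a compact set; a common element reproduces \<open>f\<close> exactly.
\<close>

lemma closedin_jet_extendable:
  fixes L :: "(complex ^ 'n) set"
  assumes L: "compact L"
  shows "closedin (mtopology_of (C_space L)) (jet_extendable L \<zeta> m)"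
proof -
  interpret Metric_space "mspace (C_space L)" "mdist (C_space L)"
    by simp
  define B where "B = ball \<zeta> (1 / Suc m)"
  define J where "J = jets B (real m)"
  have "f \<in> jet_extendable L \<zeta> m" if f: "f \<in> mtopology closure_of jet_extendable L \<zeta> m" for f
  proof -
    have f': "f \<in> mspace (C_space L)"
      using f by (simp add: metric_closure_of)
    define S where "S k =
        {G :: complex ^ 'n \<Rightarrow> complex \<times> (complex ^ 'n). \<forall>z \<in> B \<inter> L. norm (fst (G z) - f z) \<le> 1 / Suc k}"
      for k :: nat
    have clo: "closed (S k)" for k
      unfolding S_def
      by (intro closed_Collect_ball closed_Collect_le continuous_intros
            continuous_on_product_coordinates)
    have ne: "J \<inter> S k \<noteq> {}" for k
    proof -
      have "1 / real (Suc k) > 0"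
        by simp
      then obtain g where g: "g \<in> jet_extendable L \<zeta> m" "g \<in> mball f (1 / Suc k)"
        using f unfolding metric_closure_of by blast
      then obtain G where G: "G \<in> J" "\<forall>z \<in> B \<inter> L. fst (G z) = g z"
        unfolding jet_extendable_def B_def J_def by blast
      have "g \<in> mspace (C_space L)"
        using g by (simp add: jet_extendable_def)
      then have "norm (g z - f z) \<le> 1 / Suc k" if "z \<in> L" for z
        using C_space_dist_le[OF L f' _ that, of g] g(2) unfolding in_mball
        by (simp add: norm_minus_commute del: of_nat_Suc)
      then show ?thesis
        using G by (intro ex_in_conv[THEN iffD1] exI[of _ G]) (auto simp: S_def)
    qed
    have mono: "S k \<subseteq> S l" if "l \<le> k" for k l
    proof -
      have "1 / real (Suc k) \<le> 1 / real (Suc l)"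
        using that by (intro divide_left_mono) auto
      then show ?thesis
        by (auto simp: S_def simp del: of_nat_Suc intro: order_trans)
    qed
    have "J \<inter> (\<Inter>k\<in>UNIV. S k) \<noteq> {}"
    proof (rule compact_imp_fip_image)
      show "compact J"
        by (simp add: J_def compact_jets)
      show "J \<inter> (\<Inter>k\<in>I. S k) \<noteq> {}" if I: "finite I" for I
      proof -
        have "S (Max I) \<subseteq> S k" if "k \<in> I" for k
          using that I by (intro mono) simp
        then show ?thesis
          using ne[of "Max I"] by blast
      qed
    qed (rule clo)
    then obtain G where G: "G \<in> J" "\<And>k. G \<in> S k"
      by blast
    have "fst (G z) = f z" if z: "z \<in> B \<inter> L" for z
    proof (rule ccontr)
      assume "fst (G z) \<noteq> f z"
      then obtain k where "1 / Suc k < norm (fst (G z) - f z)"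
        using nat_approx_posE[of "norm (fst (G z) - f z)"] by auto
      moreover have "norm (fst (G z) - f z) \<le> 1 / Suc k"
        using G(2)[of k] z by (simp add: S_def)
      ultimately show False
        by simp
    qed
    then show ?thesis
      using G(1) f' unfolding jet_extendable_def B_def J_def by blast
  qed
  moreover have "jet_extendable L \<zeta> m \<subseteq> mspace (C_space L)"
    by (auto simp: jet_extendable_def)
  ultimately have "mtopology closure_of jet_extendable L \<zeta> m = jet_extendable L \<zeta> m"
    by (simp add: closure_of_subset subset_antisym subsetI)
  then show ?thesis
    by (metis closedin_closure_of mtopology_of_def)
qed

lemma gdelta_non_extendable_at:
  assumes "compact L"
  shows "gdelta_in (mtopology_of (C_space L)) (non_extendable_at L \<zeta>)"
proof -
  have "mspace (C_space L) - non_extendable_at L \<zeta> = (\<Union>m. jet_extendable L \<zeta> m)"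
    using extendable_iff_jet_extendable[of _ L \<zeta>]
    by (auto simp: non_extendable_at_def jet_extendable_def)
  moreover have "fsigma_in (mtopology_of (C_space L)) (\<Union>m. jet_extendable L \<zeta> m)"
    using closedin_jet_extendable[OF assms] by (intro fsigma_in_Union) (auto intro: closed_imp_fsigma_in)
  ultimately show ?thesis
    by (auto simp: gdelta_in_fsigma_in non_extendable_at_def)
qed

section \<open>Non-extendable functions are dense\<close>

lemma holomorphically_extendable_at_scaled_diff:
  assumes f: "holomorphically_extendable_at L f \<zeta>" and g: "holomorphically_extendable_at L g \<zeta>"
  shows "holomorphically_extendable_at L (\<lambda>z. a * (g z - f z)) \<zeta>"
proof -
  obtain U F where F: "open U" "\<zeta> \<in> U" "holomorphic_vec_on F U" "\<forall>z\<in>U \<inter> L. F z = f z"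
    using f unfolding holomorphically_extendable_at_def by blast
  obtain V G where G: "open V" "\<zeta> \<in> V" "holomorphic_vec_on G V" "\<forall>z\<in>V \<inter> L. G z = g z"
    using g unfolding holomorphically_extendable_at_def by blast
  have "holomorphic_vec_on (\<lambda>z. a * (G z - F z)) (U \<inter> V)"
    unfolding holomorphic_vec_on_def
  proof
    fix z assume "z \<in> U \<inter> V"
    then obtain F' G' where "(F has_derivative F') (at z)" "\<forall>c v. F' (c *s v) = c * F' v"
        "(G has_derivative G') (at z)" "\<forall>c v. G' (c *s v) = c * G' v"
      using F(3) G(3) unfolding holomorphic_vec_on_def by blast
    then show "\<exists>H'. ((\<lambda>z. a * (G z - F z)) has_derivative H') (at z) \<and> (\<forall>c v. H' (c *s v) = c * H' v)"
      by (intro exI[of _ "\<lambda>v. a * (G' v - F' v)"])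
         (auto intro!: has_derivative_mult_right has_derivative_diff simp: algebra_simps)
  qed
  then show ?thesis
    using F G unfolding holomorphically_extendable_at_def
    by (intro exI[of _ "U \<inter> V"] exI[of _ "\<lambda>z. a * (G z - F z)"]) auto
qed

lemma holomorphically_extendable_at_cong:
  assumes "\<And>z. z \<in> L \<Longrightarrow> f z = g z"
  shows "holomorphically_extendable_at L f \<zeta> \<longleftrightarrow> holomorphically_extendable_at L g \<zeta>"
  using assms by (simp add: holomorphically_extendable_at_def)

text \<open>
  An extension would vanish and be differentiable at \<open>\<zeta>\<close>, hence be at most \<open>(C + 1) * t\<close> at distance \<open>t\<close>.
  On \<open>L\<close> it equals \<open>sqrt t\<close>, which is larger when \<open>t < 1 / (C + 1)\<^sup>2\<close>, and points of \<open>L\<close> come that close.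
\<close>

lemma sqrt_dist_not_extendable:
  assumes lim: "\<zeta> islimpt L"  and \<zeta>: "\<zeta> \<in> L"
  shows "\<not> holomorphically_extendable_at L (\<lambda>z. of_real (sqrt (dist \<zeta> z))) \<zeta>"
proof
  assume "holomorphically_extendable_at L (\<lambda>z. of_real (sqrt (dist \<zeta> z))) \<zeta>"
  then obtain U F where F: "open U" "\<zeta> \<in> U" "holomorphic_vec_on F U"
      "\<forall>z\<in>U \<inter> L. F z = of_real (sqrt (dist \<zeta> z))"
    unfolding holomorphically_extendable_at_def by blast
  then obtain F' where F': "(F has_derivative F') (at \<zeta>)"
    unfolding holomorphic_vec_on_def by blast
  obtain C where C: "\<And>v. norm (F' v) \<le> norm v * C" "C > 0"
    using F' has_derivative_bounded_linear bounded_linear.pos_bounded by blast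
  obtain d where d: "d > 0"
      "\<And>z. norm (z - \<zeta>) < d \<Longrightarrow> norm (F z - F \<zeta> - F' (z - \<zeta>)) \<le> 1 * norm (z - \<zeta>)"
    using F' unfolding has_derivative_at_alt by (metis zero_less_one)
  obtain e where e: "e > 0" "ball \<zeta> e \<subseteq> U"
    using F openE by blast
  define s where "s = min (min d e) (1 / (C + 1) ^ 2)"
  have "s > 0"
    using d e C by (simp add: s_def)
  then obtain z where z: "z \<in> L" "z \<noteq> \<zeta>" "dist z \<zeta> < s"
    using lim unfolding islimpt_approachable by blast
  define t where "t = dist \<zeta> z"
  have t: "t > 0" "t < d" "t < e" "t < 1 / (C + 1) ^ 2" "t = norm (z - \<zeta>)"
    using z by (auto simp: t_def s_def dist_commute dist_norm norm_minus_commute)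
  have "F z = of_real (sqrt t)" "F \<zeta> = 0"
    using F(2,4) z(1) e t \<zeta> by (auto simp: t_def subset_iff)
  then have "sqrt t = norm (F z - F \<zeta>)"
    using t by simp
  also have "\<dots> \<le> norm (F z - F \<zeta> - F' (z - \<zeta>)) + norm (F' (z - \<zeta>))"
    using norm_triangle_sub by (simp add: add.commute)
  also have "\<dots> \<le> (C + 1) * t"
    using d(2)[of z] C(1)[of "z - \<zeta>"] t by (simp add: algebra_simps)
  finally have "sqrt t \<le> (C + 1) * sqrt t * sqrt t"
    using t by (simp add: mult.assoc)
  then have "1 \<le> (C + 1) * sqrt t"
    using t by simp
  then have "1 \<le> ((C + 1) * sqrt t) ^ 2"
    by (rule one_le_power)
  also have "\<dots> = (C + 1) ^ 2 * t"
    using t(1) by (simp only: power_mult_distrib real_sqrt_pow2 less_imp_le)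
  also have "\<dots> < 1"
    using t(4) C(2) by (simp add: pos_less_divide_eq mult.commute)
  finally show False
    by simp
qed

text \<open>
  If \<open>f\<close> extends at \<open>\<zeta>\<close> and \<open>h\<close> does not, then \<open>f + c * h\<close> does not extend for any \<open>c \<noteq> 0\<close>, since \<open>h\<close> would be a
  scaled difference of two extendable functions.
\<close>

lemma dense_gdelta_non_extendable_at:
  fixes L :: "(complex ^ 'n) set"
  assumes L: "compact L" and \<zeta>: "\<zeta> \<in> L" "\<zeta> islimpt L"
  shows "dense_gdelta_in (mtopology_of (C_space L)) (non_extendable_at L \<zeta>)"
proof -
  interpret Metric_space "mspace (C_space L)" "mdist (C_space L)"
    by simp
  define h :: "complex ^ 'n \<Rightarrow> complex" where "h z = of_real (sqrt (dist \<zeta> z))" for z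
  have conth: "continuous_on L h"
    unfolding h_def by (intro continuous_intros)
  then have "bounded (h ` L)"
    using L by (intro compact_imp_bounded compact_continuous_image)
  then obtain M where M: "\<And>z. z \<in> L \<Longrightarrow> norm (h z) \<le> M"
    unfolding bounded_iff by blast
  have M0: "M \<ge> 0"
    using M \<zeta> norm_ge_zero order_trans by blast
  have "\<exists>g \<in> non_extendable_at L \<zeta>. g \<in> mball f e"
    if f: "f \<in> mspace (C_space L)" and e: "e > 0" for f e
  proof (cases "holomorphically_extendable_at L f \<zeta>")
    case False
    then show ?thesis
      using f e by (intro bexI[of _ f]) (auto simp: non_extendable_at_def)
  next
    case True
    \<comment> \<open>This size makes the perturbation at most \<open>e / 2\<close>; adding 1 covers \<open>M = 0\<close>.\<close>
    define c where "c = e / (2 * (M + 1))"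
    define g where "g = restrict (\<lambda>z. f z + of_real c * h z) L"
    have c: "c > 0"
      using e M0 by (simp add: c_def)
    have "continuous_on L (\<lambda>z. f z + of_real c * h z)"
      using f conth by (intro continuous_intros) (auto simp: mspace_C_space[OF L])
    then have "continuous_on L g"
      by (rule continuous_on_eq) (simp add: g_def)
    then have g: "g \<in> mspace (C_space L)"
      by (simp add: mspace_C_space[OF L] g_def)
    have "\<not> holomorphically_extendable_at L g \<zeta>"
    proof
      assume "holomorphically_extendable_at L g \<zeta>"
      from holomorphically_extendable_at_scaled_diff[OF True this, of "1 / of_real c"]
      moreover have "1 / of_real c * (g z - f z) = h z" if "z \<in> L" for z
        using c that by (simp add: g_def)
      ultimately have "holomorphically_extendable_at L h \<zeta>"
        using holomorphically_extendable_at_cong by (metis (no_types, lifting))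
      then show False
        using sqrt_dist_not_extendable[OF \<zeta>(2,1)] by (simp add: h_def[abs_def])
    qed
    moreover have "mdist (C_space L) f g < e"
    proof -
      have "norm (f z - g z) \<le> e / 2" if "z \<in> L" for z
      proof -
        have "norm (f z - g z) = c * norm (h z)"
          using that c by (simp add: g_def norm_mult)
        also have "\<dots> \<le> c * (M + 1)"
          using M[OF that] c by (intro mult_left_mono) auto
        also have "\<dots> = e / 2"
          using M0 by (simp add: c_def field_simps)
        finally show ?thesis .
      qed
      then have "mdist (C_space L) f g \<le> e / 2"
        unfolding C_space_def using e by (intro mdist_cfunspace_le) (auto simp: dist_norm)
      then show ?thesis
        using e by simp
    qed
    ultimately show ?thesis
      using f g by (intro bexI[of _ g]) (auto simp: non_extendable_at_def)
  qed
  then have "mtopology closure_of non_extendable_at L \<zeta> = mspace (C_space L)"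
    by (auto simp: metric_closure_of)
  then show ?thesis
    using gdelta_non_extendable_at[OF L] by (simp add: dense_gdelta_in_def mtopology_of_def)
qed

section \<open>Functions that extend nowhere\<close>

text \<open>
  Each \<open>S i\<close> is a countable intersection of open sets, which are dense because they contain \<open>S i\<close>;
  Baire's theorem applies to all of them together.
\<close>

lemma dense_gdelta_in_INT:
  assumes X: "completely_metrizable_space X" and I: "countable I" "I \<noteq> {}"
    and S: "\<And>i. i \<in> I \<Longrightarrow> dense_gdelta_in X (S i)"
  shows "dense_gdelta_in X (\<Inter>i\<in>I. S i)"
proof -
  have "\<exists>C. (\<forall>n::nat. openin X (C n)) \<and> \<Inter>(range C) = S i" if "i \<in> I" for i
    using S[OF that] unfolding dense_gdelta_in_def gdelta_in_descending by blast
  then obtain C where C: "\<And>i n. i \<in> I \<Longrightarrow> openin X (C i (n::nat))" "\<And>i. i \<in> I \<Longrightarrow> \<Inter>(range (C i)) = S i"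
    by metis
  define \<G> where "\<G> = (\<lambda>(i, n). C i n) ` (I \<times> UNIV)"
  have "X closure_of \<Inter>\<G> = topspace X"
  proof (rule Baire_category)
    fix T assume "T \<in> \<G>"
    then obtain i n where i: "i \<in> I" "T = C i n"
      by (auto simp: \<G>_def)
    have "X closure_of S i \<subseteq> X closure_of T"
      using C(2)[OF i(1)] i(2) by (intro closure_of_mono) auto
    then show "openin X T \<and> X closure_of T = topspace X"
      using C i S[OF i(1)] closure_of_subset_topspace[of X T] by (auto simp: dense_gdelta_in_def)
  qed (use X I in \<open>auto simp: \<G>_def\<close>)
  moreover have "\<Inter>\<G> = (\<Inter>i\<in>I. S i)"
    using C(2) by (force simp: \<G>_def)
  moreover have "gdelta_in X (\<Inter>i\<in>I. S i)"
    using I S by (intro gdelta_in_Inter) (auto simp: dense_gdelta_in_def)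
  ultimately show ?thesis
    by (simp add: dense_gdelta_in_def)
qed

lemma completely_metrizable_C_space: "completely_metrizable_space (mtopology_of (C_space L))"
proof -
  have "mcomplete_of (C_space L)"
    unfolding C_space_def euclidean_metric_def Met_TC.Self_def[symmetric]
    by (rule Met_TC.mcomplete_cfunspace) (simp add: complete_UNIV)
  then show ?thesis
    unfolding mcomplete_of_def mtopology_of_def
    by (simp add: Metric_space.completely_metrizable_space_mtopology)
qed

text \<open>
  A function that extends at some point of \<open>L\<close> extends with the same neighbourhood at every point of
  \<open>L\<close> in it, in particular at a point of a fixed countable dense subset.
\<close>

lemma dense_gdelta_nowhere_extendable:
  assumes L: "compact L" "L \<noteq> {}" and lim: "\<And>\<zeta>. \<zeta> \<in> L \<Longrightarrow> \<zeta> islimpt L"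
  shows "dense_gdelta_in (mtopology_of (C_space L)) (nowhere_extendable L)"
proof -
  obtain T where T: "countable T" "T \<subseteq> L" "L \<subseteq> closure T"
    using separable by blast
  have "f \<in> nowhere_extendable L" if f: "\<forall>\<zeta>\<in>T. f \<in> non_extendable_at L \<zeta>" for f
  proof -
    have "\<not> holomorphically_extendable_at L f \<zeta>" if \<zeta>: "\<zeta> \<in> L" for \<zeta>
    proof
      assume "holomorphically_extendable_at L f \<zeta>"
      then obtain U F where F: "open U" "\<zeta> \<in> U" "holomorphic_vec_on F U" "\<forall>z\<in>U \<inter> L. F z = f z"
        unfolding holomorphically_extendable_at_def by blast
      then obtain \<tau> where "\<tau> \<in> T" "\<tau> \<in> U"
        using T(3) \<zeta> open_Int_closure_eq_empty[of U T] by blast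
      then show False
        using f F unfolding non_extendable_at_def holomorphically_extendable_at_def by blast
    qed
    moreover have "T \<noteq> {}"
      using T L by auto
    ultimately show ?thesis
      using f by (auto simp: nowhere_extendable_def non_extendable_at_def)
  qed
  then have "nowhere_extendable L = (\<Inter>\<zeta>\<in>T. non_extendable_at L \<zeta>)"
    using T by (auto simp: nowhere_extendable_def non_extendable_at_def)
  moreover have "dense_gdelta_in (mtopology_of (C_space L)) (\<Inter>\<zeta>\<in>T. non_extendable_at L \<zeta>)"
    using T L lim
    by (intro dense_gdelta_in_INT completely_metrizable_C_space dense_gdelta_non_extendable_at) auto
  ultimately show ?thesis
    by simp
qed

section \<open>Boundaries of circled domains\<close>

lemma frontier_circled:
  fixes U :: "(complex ^ 'n) set"
  assumes circled: "\<And>u z. norm u = 1 \<Longrightarrow> z \<in> U \<Longrightarrow> u *s z \<in> U"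
    and u: "norm u = 1" and z: "z \<in> frontier U"
  shows "u *s z \<in> frontier U"
proof -
  have u0: "u \<noteq> 0"
    using u by auto
  have inv: "inverse u *s (u *s w) = w" "u *s (inverse u *s w) = w" for w :: "complex ^ 'n"
    using u0 by simp_all
  have "(\<lambda>z. u *s z) ` U = U"
  proof
    show "(\<lambda>z. u *s z) ` U \<subseteq> U"
      using circled u by auto
    show "U \<subseteq> (\<lambda>z. u *s z) ` U"
    proof
      fix w assume "w \<in> U"
      then have "inverse u *s w \<in> U"
        using u by (intro circled) (simp_all add: norm_inverse)
      then show "w \<in> (\<lambda>z. u *s z) ` U"
        using inv(2)[of w] by (metis imageI)
    qed
  qed
  moreover have "linear (\<lambda>z. u *s z :: complex ^ 'n)"
    using bounded_linear_smult_left bounded_linear.linear by blast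
  moreover have "inj (\<lambda>z. u *s z :: complex ^ 'n)"
    using inv(1) by (metis injI)
  ultimately have "(\<lambda>z. u *s z) ` closure U = closure U" "(\<lambda>z. u *s z) ` interior U = interior U"
    using closure_injective_linear_image interior_injective_linear_image by metis+
  then show ?thesis
    using z inv(1) unfolding frontier_def by (metis (no_types, lifting) DiffD1 DiffD2 DiffI imageE imageI)
qed

text \<open>
  The orbit of \<open>\<zeta>\<close> under multiplication by unimodular numbers is a connected subset of the boundary.
  It contains \<open>\<zeta>\<close> and \<open>-\<zeta>\<close>, which differ because 0 is an interior point, so \<open>\<zeta>\<close> is not isolated.
\<close>

lemma frontier_circled_islimpt:
  fixes U :: "(complex ^ 'n) set"
  assumes circled: "\<And>u z. norm u = 1 \<Longrightarrow> z \<in> U \<Longrightarrow> u *s z \<in> U"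
    and U: "open U" "0 \<in> U" and \<zeta>: "\<zeta> \<in> frontier U"
  shows "\<zeta> islimpt frontier U"
proof -
  define C where "C = (\<lambda>u. u *s \<zeta>) ` sphere 0 1"
  have \<zeta>0: "\<zeta> \<noteq> 0"
    using U \<zeta> by (auto simp: frontier_def interior_open)
  have "\<zeta> islimpt C"
  proof (rule connected_imp_perfect)
    show "connected C"
      unfolding C_def
      by (intro connected_continuous_image linear_continuous_on bounded_linear_smult_right connected_sphere) simp
    have C: "1 *s \<zeta> \<in> C" "(-1) *s \<zeta> \<in> C"
      unfolding C_def by (rule imageI, simp)+
    then show "\<zeta> \<in> C"
      by simp
    have "(-1) *s \<zeta> \<noteq> 1 *s \<zeta>"
      using \<zeta>0 by (auto simp: vec_eq_iff complex_eq_iff)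
    then show "C \<noteq> {x}" for x
      using C by (metis singletonD)
  qed
  moreover have "C \<subseteq> frontier U"
    using frontier_circled[OF circled _ \<zeta>] by (auto simp: C_def)
  ultimately show ?thesis
    by (rule islimpt_subset)
qed

lemma dense_gdelta_frontier_circled:
  fixes U :: "(complex ^ 'n) set"
  assumes circled: "\<And>u z. norm u = 1 \<Longrightarrow> z \<in> U \<Longrightarrow> u *s z \<in> U"
    and U: "open U" "0 \<in> U" "bounded U"
  shows "(\<forall>\<zeta>\<in>frontier U.
         dense_gdelta_in (mtopology_of (C_space (frontier U))) (non_extendable_at (frontier U) \<zeta>))
      \<and> dense_gdelta_in (mtopology_of (C_space (frontier U))) (nowhere_extendable (frontier U))"
proof -
  have "compact (frontier U)"
    using U by blast
  moreover have "frontier U \<noteq> {}"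
    using U not_bounded_UNIV[where 'a = "complex ^ 'n"] by (auto simp: frontier_eq_empty)
  moreover have "\<zeta> islimpt frontier U" if "\<zeta> \<in> frontier U" for \<zeta>
    using frontier_circled_islimpt[OF circled U(1,2) that] .
  ultimately show ?thesis
    using dense_gdelta_non_extendable_at dense_gdelta_nowhere_extendable by blast
qed

section \<open>Polydisc and ball\<close>

lemma open_unit_polydisc: "open unit_polydisc"
  unfolding unit_polydisc_def Collect_all_eq
  by (intro open_INT ballI open_Collect_less continuous_intros) simp

lemma bounded_unit_polydisc: "bounded (unit_polydisc :: (complex ^ 'n) set)"
proof (rule boundedI)
  fix z :: "complex ^ 'n" assume "z \<in> unit_polydisc"
  then have "(\<Sum>i\<in>UNIV. norm (z $ i)) \<le> (\<Sum>i\<in>(UNIV :: 'n set). 1)"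
    by (intro sum_mono) (auto simp: unit_polydisc_def less_imp_le)
  then show "norm z \<le> real CARD('n)"
    unfolding norm_vec_def using L2_set_le_sum[of UNIV "\<lambda>i. norm (z $ i)"] by simp
qed

theorem theorem14:
  fixes D B :: "(complex ^ 'n) set"
  defines "D \<equiv> unit_polydisc" and "B \<equiv> ball 0 1"
  shows
    "((\<forall>\<zeta>\<in>frontier D.
         dense_gdelta_in (mtopology_of (C_space (frontier D))) (non_extendable_at (frontier D) \<zeta>))
      \<and> dense_gdelta_in (mtopology_of (C_space (frontier D))) (nowhere_extendable (frontier D)))
   \<and> ((\<forall>\<zeta>\<in>frontier B.
         dense_gdelta_in (mtopology_of (C_space (frontier B))) (non_extendable_at (frontier B) \<zeta>))
      \<and> dense_gdelta_in (mtopology_of (C_space (frontier B))) (nowhere_extendable (frontier B)))"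
proof (rule conjI)
  show "(\<forall>\<zeta>\<in>frontier D.
         dense_gdelta_in (mtopology_of (C_space (frontier D))) (non_extendable_at (frontier D) \<zeta>))
      \<and> dense_gdelta_in (mtopology_of (C_space (frontier D))) (nowhere_extendable (frontier D))"
    unfolding D_def
    by (rule dense_gdelta_frontier_circled)
       (auto simp: open_unit_polydisc bounded_unit_polydisc, auto simp: unit_polydisc_def norm_mult)
  show "(\<forall>\<zeta>\<in>frontier B.
         dense_gdelta_in (mtopology_of (C_space (frontier B))) (non_extendable_at (frontier B) \<zeta>))
      \<and> dense_gdelta_in (mtopology_of (C_space (frontier B))) (nowhere_extendable (frontier B))"
    unfolding B_def
    by (rule dense_gdelta_frontier_circled) (auto simp: norm_smult_vec)
qed

end
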